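(* If $(\mathcal{A}_k)_{k\ge 1}$ is a sequence of labyrinth patterns, then the limit set generated by the sequence of the corresponding complementary patterns $(\overline{\mathcal{A}}_k)_{k\ge 1}$ is a totally disconnected generalised Sierpi\'nski carpet.
   Context: Patterns. For an integer $m\ge 1$ let $S_{i,j,m}=\{(x,y)\mid \frac{i}{m}\le x\le \frac{i+1}{m},\ \frac{j}{m}\le y\le\frac{j+1}{m}\}$ and $\mathcal{S}_m=\{S_{i,j,m}\mid 0\le i\le m-1,\ 0\le j\le m-1\}$. A nonempty subset $\mathcal{A}\subseteq\mathcal{S}_m$ is called an $m$-pattern of width $m$; its elements are called its white squares. The complementary pattern of an $m$-pattern $\mathcal{A}$ is $\overline{\mathcal{A}}=\mathcal{S}_m\setminus\mathcal{A}$. Graph, exits. $\mathcal{G}(\mathcal{A})$ is the graph whose vertices are the white squares of $\mathcal{A}$ and whose edges are the unordered pairs of distinct white squares having a common side. The top (bottom) row of $\mathcal{A}$ is the set of white squares $S_{i,j,m}\in\mathcal{A}$ with $j=m-1$ ($j=0$); the left (right) column is the set of those with $i=0$ ($i=m-1$). A top exit is a white square in the top row such that there is a white square in the same column in the bottom row, the latter being the corresponding bottom exit; together they form a vertical exit pair. A left exit is a white square in the left column such that there is a white square in the same row in the right column, the latter being the corresponding right exit; together they form a horizontal exit pair. Labyrinth pattern. An $m$-pattern $\mathcal{A}$ with $m\ge 3$ is a labyrinth pattern if: (1) $\mathcal{G}(\mathcal{A})$ is a tree; (2) $\mathcal{A}$ has exactly one vertical exit pair and exactly one horizontal exit pair;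 (3) if there is a white square in $\mathcal{A}$ at a corner of the unit square, then there is no white square in $\mathcal{A}$ at the diagonally opposite corner. Limit set. For a square $Q=[x,x+q]\times[y,y+q]\subseteq[0,1]^2$ put $P_Q(z_x,z_y)=(qz_x+x,\,qz_y+y)$. Given any sequence of patterns $\mathcal{C}_k\subseteq\mathcal{S}_{m_k}$, $k\ge 1$, let $\mathcal{W}_1=\mathcal{C}_1$ and, for $n\ge 2$, $\mathcal{W}_n=\{P_{V}(W)\mid W\in\mathcal{C}_n,\ V\in\mathcal{W}_{n-1}\}$. Let $L_n=\bigcup_{W\in\mathcal{W}_n}W$. The limit set generated by the sequence is $L_\infty=\bigcap_{n\ge 1}L_n$; limit sets generated in this way by sequences of patterns are called generalised Sierpi\'nski carpets. *)

theory Defs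
  imports "HOL-Analysis.Analysis"
begin

section \<open>Undirected graphs and trees\<close>

text \<open>A graph is a vertex set together with a set of unordered pairs of vertices.\<close>

definition walk :: "'a set \<Rightarrow> 'a set set \<Rightarrow> 'a list \<Rightarrow> bool" where
  "walk V E p \<longleftrightarrow>
     p \<noteq> [] \<and> set p \<subseteq> V \<and> (\<forall>i. Suc i < length p \<longrightarrow> {p ! i, p ! Suc i} \<in> E)"

definition graph_connected :: "'a set \<Rightarrow> 'a set set \<Rightarrow> bool" where
  "graph_connected V E \<longleftrightarrow>
     V \<noteq> {} \<and> (\<forall>u\<in>V. \<forall>v\<in>V. \<exists>p. walk V E p \<and> hd p = u \<and> last p = v)"

definition graph_cycle :: "'a set \<Rightarrow> 'a set set \<Rightarrow> 'a list \<Rightarrow> bool" where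
  "graph_cycle V E p \<longleftrightarrow>
     walk V E p \<and> distinct p \<and> length p \<ge> 3 \<and> {last p, hd p} \<in> E"

definition is_tree :: "'a set \<Rightarrow> 'a set set \<Rightarrow> bool" where
  "is_tree V E \<longleftrightarrow> graph_connected V E \<and> (\<nexists>p. graph_cycle V E p)"

section \<open>Patterns\<close>

definition grid_square :: "nat \<Rightarrow> nat \<Rightarrow> nat \<Rightarrow> (real \<times> real) set" where
  "grid_square m i j =
     {(x, y). real i / real m \<le> x \<and> x \<le> (real i + 1) / real m \<and>
              real j / real m \<le> y \<and> y \<le> (real j + 1) / real m}"

definition grid :: "nat \<Rightarrow> (real \<times> real) set set" where
  "grid m = {grid_square m i j | i j. i < m \<and> j < m}"

definition pattern :: "nat \<Rightarrow> (real \<times> real) set set \<Rightarrow> bool" where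
  "pattern m A \<longleftrightarrow> m \<ge> 1 \<and> A \<subseteq> grid m \<and> A \<noteq> {}"

definition complementary_pattern ::
    "nat \<Rightarrow> (real \<times> real) set set \<Rightarrow> (real \<times> real) set set" where
  "complementary_pattern m A = grid m - A"

section \<open>The graph of a pattern, exits, labyrinth patterns\<close>

definition square :: "real \<Rightarrow> real \<Rightarrow> real \<Rightarrow> (real \<times> real) set" where
  "square x y q = {x..x + q} \<times> {y..y + q}"

definition sides :: "(real \<times> real) set \<Rightarrow> (real \<times> real) set set" where
  "sides Q = {s. \<exists>x y q. q > 0 \<and> Q = square x y q \<and>
     s \<in> {{x} \<times> {y..y + q}, {x + q} \<times> {y..y + q}, {x..x + q} \<times> {y}, {x..x + q} \<times> {y + q}}}"

definition pattern_edges :: "(real \<times> real) set set \<Rightarrow> (real \<times> real) set set set" where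
  "pattern_edges A = {{V, W} | V W. V \<in> A \<and> W \<in> A \<and> V \<noteq> W \<and> sides V \<inter> sides W \<noteq> {}}"

definition vertical_exit_pairs ::
    "nat \<Rightarrow> (real \<times> real) set set \<Rightarrow> ((real \<times> real) set \<times> (real \<times> real) set) set" where
  "vertical_exit_pairs m A =
     {(grid_square m i (m - 1), grid_square m i 0) | i.
        i < m \<and> grid_square m i (m - 1) \<in> A \<and> grid_square m i 0 \<in> A}"

definition horizontal_exit_pairs ::
    "nat \<Rightarrow> (real \<times> real) set set \<Rightarrow> ((real \<times> real) set \<times> (real \<times> real) set) set" where
  "horizontal_exit_pairs m A =
     {(grid_square m 0 j, grid_square m (m - 1) j) | j.
        j < m \<and> grid_square m 0 j \<in> A \<and> grid_square m (m - 1) j \<in> A}"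

definition labyrinth_pattern :: "nat \<Rightarrow> (real \<times> real) set set \<Rightarrow> bool" where
  "labyrinth_pattern m A \<longleftrightarrow>
     m \<ge> 3 \<and> pattern m A \<and>
     is_tree A (pattern_edges A) \<and>
     (\<exists>!p. p \<in> vertical_exit_pairs m A) \<and>
     (\<exists>!p. p \<in> horizontal_exit_pairs m A) \<and>
     (\<forall>i\<in>{0, m - 1}. \<forall>j\<in>{0, m - 1}.
        grid_square m i j \<in> A \<longrightarrow> grid_square m (m - 1 - i) (m - 1 - j) \<notin> A)"

section \<open>Limit sets\<close>

definition sq_map :: "real \<Rightarrow> real \<Rightarrow> real \<Rightarrow> real \<times> real \<Rightarrow> real \<times> real" where
  "sq_map x y q z = (q * fst z + x, q * snd z + y)"

text \<open>Sequences are indexed from 1; the value at index 0 is a dummy and is never used.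
  The parameters of a square of positive side length are determined by the square.\<close>

fun white_squares :: "(nat \<Rightarrow> (real \<times> real) set set) \<Rightarrow> nat \<Rightarrow> (real \<times> real) set set" where
  "white_squares C 0 = {}"
| "white_squares C (Suc 0) = C 1"
| "white_squares C (Suc (Suc n)) =
     {sq_map x y q ` W | x y q W.
        W \<in> C (Suc (Suc n)) \<and> q > 0 \<and> square x y q \<in> white_squares C (Suc n)}"

definition limit_set :: "(nat \<Rightarrow> (real \<times> real) set set) \<Rightarrow> (real \<times> real) set" where
  "limit_set C = (\<Inter>n\<in>{1..}. \<Union>(white_squares C n))"

definition generalised_sierpinski_carpet :: "(real \<times> real) set \<Rightarrow> bool" where
  "generalised_sierpinski_carpet K \<longleftrightarrow>
     (\<exists>m C. (\<forall>k\<ge>1. pattern (m k) (C k)) \<and> K = limit_set C)"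

definition totally_disconnected :: "'a::topological_space set \<Rightarrow> bool" where
  "totally_disconnected S \<longleftrightarrow> (\<forall>x\<in>S. connected_component_set S x = {x})"

end

theory Submission
  imports Defs
begin

text \<open>
  Fix a level \<open>n\<close> and a column of squares of that level. In every square of the column, either the
  square itself has been discarded or the next step discards a copy of the labyrinth pattern, whose
  tree contains a chain from the bottom exit to the top exit. The two exits of a vertical pair lie in
  the same column of the pattern, so these chains join up to a chain of edge-adjacent discarded cells
  crossing the whole column from bottom to top. By the Fashoda meet theorem no connected subset of
  the limit set can pass from one side of the column to the other. Hence a connected subset has
  horizontal extent at most two level-\<open>n\<close> side lengths, for every \<open>n\<close>; exchanging the coordinates
  handles the vertical extent.
\<close>

section \<open>Geometry of grid squares\<close>

lemma square_eq_iff: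
  assumes "q > 0" "q' > 0"
  shows "square x y q = square x' y' q' \<longleftrightarrow> x = x' \<and> y = y' \<and> q = q'"
  using assms by (auto simp: square_def times_eq_iff)

lemma grid_square_eq_square:
  "grid_square m i j = square (real i / real m) (real j / real m) (1 / real m)"
  by (auto simp: grid_square_def square_def add_divide_distrib)

lemma sq_map_square:
  assumes "q > 0"
  shows "sq_map x y q ` square x' y' q' = square (q * x' + x) (q * y' + y) (q * q')"
proof -
  have "sq_map x y q ` square x' y' q' =
      (\<lambda>t. q * t + x) ` {x'..x' + q'} \<times> (\<lambda>t. q * t + y) ` {y'..y' + q'}"
    by (force simp: square_def sq_map_def image_iff)
  moreover have "(\<lambda>t. q * t + a) ` {b..b + q'} = {q * b + a..q * b + a + q * q'}" for a b
    using assms image_affinity_atLeastAtMost[of q a b "b + q'"] by (cases "b \<le> b + q'") (auto simp: algebra_simps zero_le_mult_iff)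
  ultimately show ?thesis
    by (simp add: square_def)
qed

lemma sq_map_grid_square:
  assumes "M > 0" "m > 0"
  shows "sq_map (real a / real M) (real b / real M) (1 / real M) ` grid_square m i j =
         grid_square (M * m) (a * m + i) (b * m + j)"
  using assms
  by (simp add: grid_square_eq_square sq_map_square add_divide_distrib add.commute)

lemma swap_grid_square: "prod.swap ` grid_square m i j = grid_square m j i"
  by (force simp: grid_square_def image_iff)

lemma in_grid_square_iff:
  assumes "m > 0"
  shows "(x, y) \<in> grid_square m i j \<longleftrightarrow>
    real i \<le> m * x \<and> m * x \<le> real i + 1 \<and> real j \<le> m * y \<and> m * y \<le> real j + 1"
  using assms by (simp add: grid_square_def field_simps)

lemma side_subset: "s \<in> sides Q \<Longrightarrow> s \<subseteq> Q"
  by (auto simp: sides_def square_def)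

lemma side_two_points:
  assumes "s \<in> sides Q"
  obtains u v where "u \<in> s" "v \<in> s" "u \<noteq> v"
proof -
  obtain x y q where q: "q > 0" and
    s: "s \<in> {{x} \<times> {y..y + q}, {x + q} \<times> {y..y + q}, {x..x + q} \<times> {y}, {x..x + q} \<times> {y + q}}"
    using assms unfolding sides_def by blast
  from s consider "(x, y) \<in> s" "(x, y + q) \<in> s" | "(x + q, y) \<in> s" "(x + q, y + q) \<in> s"
    | "(x, y) \<in> s" "(x + q, y) \<in> s" | "(x, y + q) \<in> s" "(x + q, y + q) \<in> s"
    using q by auto
  then show thesis
    using that q by cases force+
qed

section \<open>Chains of adjacent cells\<close>

definition adjacent :: "nat \<times> nat \<Rightarrow> nat \<times> nat \<Rightarrow> bool" where
  "adjacent u v \<longleftrightarrow>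
     fst u = fst v \<and> (snd u = Suc (snd v) \<or> snd v = Suc (snd u)) \<or>
     snd u = snd v \<and> (fst u = Suc (fst v) \<or> fst v = Suc (fst u))"

definition cell_step :: "(nat \<times> nat) set \<Rightarrow> ((nat \<times> nat) \<times> (nat \<times> nat)) set" where
  "cell_step B = {(u, v). u \<in> B \<and> v \<in> B \<and> adjacent u v}"

text \<open>Both ends lie in the same column \<open>i\<close>, which is what lets crossings of
  stacked squares be joined. Membership of the first cell is demanded separately because the
  reflexive closure relates even a cell outside \<open>B\<close> to itself.\<close>

definition vertical_crossing :: "nat \<Rightarrow> (nat \<times> nat) set \<Rightarrow> bool" where
  "vertical_crossing m B \<longleftrightarrow>
     (\<exists>i<m. (i, 0) \<in> B \<and> ((i, 0), (i, m - 1)) \<in> (cell_step B)\<^sup>*)"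

definition cells :: "nat \<Rightarrow> (real \<times> real) set set \<Rightarrow> (nat \<times> nat) set" where
  "cells m A = {(i, j). i < m \<and> j < m \<and> grid_square m i j \<in> A}"

text \<open>A common point forces the indices to differ by at most one in each coordinate, and a
  difference in one coordinate fixes that coordinate of every common point. A difference in both
  would leave a single common point, but a side contains two.\<close>

lemma adjacent_if_common_side:
  assumes m: "m > 0"
    and ne: "grid_square m i j \<noteq> grid_square m i' j'"
    and "sides (grid_square m i j) \<inter> sides (grid_square m i' j') \<noteq> {}"
  shows "adjacent (i, j) (i', j')"
proof -
  obtain s where s: "s \<in> sides (grid_square m i j)" "s \<in> sides (grid_square m i' j')"
    using assms(3) by blast
  obtain u v where uv: "u \<in> s" "v \<in> s" "u \<noteq> v"
    using side_two_points s(1) by blast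
  obtain x y x' y' where [simp]: "u = (x, y)" "v = (x', y')"
    by (metis surj_pair)
  have mem: "(x, y) \<in> grid_square m i j" "(x, y) \<in> grid_square m i' j'"
    "(x', y') \<in> grid_square m i j" "(x', y') \<in> grid_square m i' j'"
    using side_subset s uv by auto
  note bounds = mem[unfolded in_grid_square_iff[OF m]]
  have "m * x \<noteq> m * x' \<or> m * y \<noteq> m * y'"
    using uv(3) m by auto
  moreover have "i' \<le> Suc i" "i \<le> Suc i'" "j' \<le> Suc j" "j \<le> Suc j'"
    using bounds by linarith+
  moreover have "m * x = m * x'" if "i \<noteq> i'"
    using that bounds calculation(2,3) by linarith
  moreover have "m * y = m * y'" if "j \<noteq> j'"
    using that bounds calculation(4,5) by linarith
  ultimately have "i = i' \<or> j = j'" "i \<noteq> i' \<or> j \<noteq> j'"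
    using ne by auto
  with \<open>i' \<le> Suc i\<close> \<open>i \<le> Suc i'\<close> \<open>j' \<le> Suc j\<close> \<open>j \<le> Suc j'\<close> show ?thesis
    unfolding adjacent_def by auto
qed

lemma grid_square_inject:
  assumes "m > 0"
  shows "grid_square m i j = grid_square m i' j' \<longleftrightarrow> i = i' \<and> j = j'"
  using assms by (simp add: grid_square_eq_square square_eq_iff)

lemma walk_imp_chain:
  assumes A: "A \<subseteq> grid m" and m: "m > 0"
    and "walk A (pattern_edges A) p"
    and "hd p = grid_square m i j" "last p = grid_square m i' j'"
    and "i < m" "j < m" "i' < m" "j' < m"
  shows "((i, j), (i', j')) \<in> (cell_step (cells m A))\<^sup>*"
  using assms(3-)
proof (induction p arbitrary: i j)
  case Nil
  then show ?case by (simp add: walk_def)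
next
  case (Cons V p)
  show ?case
  proof (cases "p = []")
    case True
    with Cons.prems m show ?thesis by (simp add: grid_square_inject)
  next
    case False
    have VA: "V \<in> A" "hd p \<in> A"
      using Cons.prems(1) False by (auto simp: walk_def)
    then obtain k l where kl: "hd p = grid_square m k l" "k < m" "l < m"
      using A by (auto simp: grid_def)
    have V: "V = grid_square m i j"
      using Cons.prems by simp
    have "{(V # p) ! i, (V # p) ! Suc i} \<in> pattern_edges A" if "Suc i < length (V # p)" for i
      using Cons.prems(1) that by (simp only: walk_def)
    then have edge: "{(V # p) ! i, (V # p) ! Suc i} \<in> pattern_edges A" if "i < length p" for i
      using that by simp
    have "walk A (pattern_edges A) p"
      using Cons.prems(1) False edge[of "Suc _"] by (auto simp: walk_def)
    then have "((k, l), (i', j')) \<in> (cell_step (cells m A))\<^sup>*"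
      using Cons.IH kl Cons.prems False by simp
    moreover have "{V, hd p} \<in> pattern_edges A"
      using edge[of 0] False by (simp add: hd_conv_nth)
    then have "V \<noteq> hd p" "sides V \<inter> sides (hd p) \<noteq> {}"
      unfolding pattern_edges_def by (auto simp: doubleton_eq_iff)
    then have "adjacent (i, j) (k, l)"
      using adjacent_if_common_side[OF m] V kl by metis
    then have "((i, j), (k, l)) \<in> cell_step (cells m A)"
      using VA V kl Cons.prems by (simp add: cell_step_def cells_def)
    ultimately show ?thesis
      by (rule converse_rtrancl_into_rtrancl[rotated])
  qed
qed

section \<open>Exchange of coordinates and chains between exits\<close>

lemma adjacent_swap: "adjacent (prod.swap u) (prod.swap v) \<longleftrightarrow> adjacent u v"
  by (auto simp: adjacent_def)

lemma cell_step_swap: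
  assumes "(u, v) \<in> (cell_step B)\<^sup>*"
  shows "(prod.swap u, prod.swap v) \<in> (cell_step (prod.swap ` B))\<^sup>*"
  using assms
proof induction
  case (step y z)
  then have "(prod.swap y, prod.swap z) \<in> cell_step (prod.swap ` B)"
    by (auto simp: cell_step_def adjacent_swap simp del: swap_simp)
  with step show ?case by simp
qed simp

text \<open>Connectedness of the tree yields a chain between any two white cells, in particular
  between the two squares of an exit pair. The second claim is the horizontal exit pair seen after
  exchanging the coordinates, so that one argument about columns serves both directions.\<close>

lemma labyrinth_pattern_crossings:
  assumes "labyrinth_pattern m A"
  shows "vertical_crossing m (cells m A)" "vertical_crossing m (prod.swap ` cells m A)"
proof -
  have m: "m > 0" and A: "A \<subseteq> grid m"
    and conn: "graph_connected A (pattern_edges A)"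
    and ver: "\<exists>p. p \<in> vertical_exit_pairs m A" and hor: "\<exists>p. p \<in> horizontal_exit_pairs m A"
    using assms by (auto simp: labyrinth_pattern_def pattern_def is_tree_def)
  have chain: "((i, j), (i', j')) \<in> (cell_step (cells m A))\<^sup>*"
    if "(i, j) \<in> cells m A" "(i', j') \<in> cells m A" for i j i' j'
  proof -
    have "grid_square m i j \<in> A" "grid_square m i' j' \<in> A"
      using that by (auto simp: cells_def)
    then obtain p where "walk A (pattern_edges A) p" "hd p = grid_square m i j"
        "last p = grid_square m i' j'"
      using conn unfolding graph_connected_def by blast
    then show ?thesis
      using walk_imp_chain[OF A m] that by (auto simp: cells_def)
  qed
  obtain i where "i < m" "grid_square m i (m - 1) \<in> A" "grid_square m i 0 \<in> A"
    using ver by (auto simp: vertical_exit_pairs_def)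
  then have "(i, 0) \<in> cells m A" "(i, m - 1) \<in> cells m A"
    using m by (auto simp: cells_def)
  with chain \<open>i < m\<close> show "vertical_crossing m (cells m A)"
    unfolding vertical_crossing_def by blast
  obtain j where "j < m" "grid_square m 0 j \<in> A" "grid_square m (m - 1) j \<in> A"
    using hor by (auto simp: horizontal_exit_pairs_def)
  then have j: "(0, j) \<in> cells m A" "(m - 1, j) \<in> cells m A"
    using m by (auto simp: cells_def)
  then have "((j, 0), (j, m - 1)) \<in> (cell_step (prod.swap ` cells m A))\<^sup>*"
    using cell_step_swap[OF chain[OF j]] by simp
  moreover have "(j, 0) \<in> prod.swap ` cells m A"
    using j by force
  ultimately show "vertical_crossing m (prod.swap ` cells m A)"
    using \<open>j < m\<close> unfolding vertical_crossing_def by blast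
qed

section \<open>Separation by a chain of cells\<close>

text \<open>The Fashoda meet theorem is stated in \<open>real^2\<close>; the coordinatewise map
  \<open>h\<close> is continuous and injective, so the intersection point transfers back to the
  product plane.\<close>

lemma fashoda_prod:
  fixes f g :: "real \<Rightarrow> real \<times> real"
  assumes "path f" "path g"
    and "path_image f \<subseteq> {0..1} \<times> {0..1}" "path_image g \<subseteq> {0..1} \<times> {0..1}"
    and "fst (pathstart f) = 0" "fst (pathfinish f) = 1"
    and "snd (pathstart g) = 0" "snd (pathfinish g) = 1"
  shows "path_image f \<inter> path_image g \<noteq> {}"
proof -
  define h :: "real \<times> real \<Rightarrow> real^2" where "h = (\<lambda>z. \<chi> i. if i = 1 then fst z else snd z)"
  have h: "h z $ 1 = fst z" "h z $ 2 = snd z" for z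
    by (simp_all add: h_def)
  have "continuous_on S (\<lambda>z::real \<times> real. if i = (1::2) then fst z else snd z)" for S i
    by (cases "i = 1") (auto intro!: continuous_intros)
  then have "continuous_on S h" for S
    unfolding h_def by (rule continuous_on_vec_lambda)
  then have paths: "path (h \<circ> f)" "path (h \<circ> g)"
    using assms(1,2) path_continuous_image by blast+
  have box: "h z \<in> cbox 0 1" if "z \<in> {0..1} \<times> {0..1}" for z
    using that by (auto simp: mem_box_cart forall_2 h)
  obtain w where w: "w \<in> path_image (h \<circ> f)" "w \<in> path_image (h \<circ> g)"
    by (rule fashoda[OF paths, of 0 1])
      (use assms box in \<open>auto simp: path_image_compose pathstart_compose pathfinish_compose h\<close>)
  then obtain u v where "u \<in> path_image f" "v \<in> path_image g" "h u = h v"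
    by (auto simp: path_image_compose)
  then show ?thesis
    using h by (metis IntI empty_iff prod_eqI)
qed

section \<open>Polygonal paths through the centers of cells\<close>

definition center :: "nat \<Rightarrow> nat \<times> nat \<Rightarrow> real \<times> real" where
  "center N u = ((real (fst u) + 1/2) / real N, (real (snd u) + 1/2) / real N)"

lemma path_component_segment:
  fixes a b :: "'a::real_normed_vector"
  shows "closed_segment a b \<subseteq> S \<Longrightarrow> path_component S a b"
  unfolding path_component_def by (intro exI[of _ "linepath a b"]) simp

text \<open>Coordinates are scaled by \<open>N\<close>, so that membership in a cell turns into
  linear inequalities between reals and indices.\<close>

lemma center_segmentE:
  assumes N: "N > 0" and "(x, y) \<in> closed_segment (center N (i, j)) (center N (i', j'))"
  obtains t where "0 \<le> t" "t \<le> 1"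
    "N * x = real i + 1/2 + t * (real i' - real i)" "N * y = real j + 1/2 + t * (real j' - real j)"
proof -
  have scale: "N * ((1 - t) * (a / N) + t * (b / N)) = a + t * (b - a)" for t a b :: real
  proof -
    have "N * ((1 - t) * (a / N) + t * (b / N)) = (1 - t) * (N * (a / N)) + t * (N * (b / N))"
      by (simp only: distrib_left mult.left_commute)
    also have "\<dots> = a + t * (b - a)"
      using N by (simp add: algebra_simps)
    finally show ?thesis .
  qed
  obtain t where t: "0 \<le> t" "t \<le> 1"
    and "x = (1 - t) * ((real i + 1/2) / N) + t * ((real i' + 1/2) / N)"
    and "y = (1 - t) * ((real j + 1/2) / N) + t * ((real j' + 1/2) / N)"
    using assms(2) by (auto simp: in_segment center_def)
  then show thesis
    using that[OF t] by (simp only: scale add_diff_cancel_right)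
qed

text \<open>This is where the crossing path may run. The strip is open horizontally, so the path
  stays off both lines bounding the column, and closed vertically, so the path can end on the bottom
  and top edges of the unit square.\<close>

definition chain_region :: "nat \<Rightarrow> nat \<Rightarrow> nat \<Rightarrow> (nat \<times> nat) set \<Rightarrow> (real \<times> real) set" where
  "chain_region N l r T =
     {real l / real N<..<real r / real N} \<times> {0..1} - (\<Union>(i, j)\<in>T. grid_square N i j)"

text \<open>Cells are closed, so a boundary point lies in several of them. If all of these have
  indices in \<open>S\<close>, none belongs to the disjoint set \<open>T\<close>.\<close>

lemma chain_regionI:
  assumes N: "N > 0" and ST: "S \<inter> T = {}"
    and "real l < N * x" "N * x < real r" "0 \<le> y" "y \<le> 1"
    and "\<And>i j. (x, y) \<in> grid_square N i j \<Longrightarrow> (i, j) \<in> S"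
  shows "(x, y) \<in> chain_region N l r T"
  using assms by (auto simp: chain_region_def field_simps)

text \<open>The segment between the centers of two edge-adjacent cells passes through the midpoint
  of their common side. It avoids all corners, hence touches no third closed cell.\<close>

lemma adjacent_segment_subset_chain_region:
  assumes N: "N > 0" and ST: "S \<inter> T = {}" and S: "S \<subseteq> {l..<r} \<times> {..<N}"
    and uv: "u \<in> S" "v \<in> S" "adjacent u v"
  shows "closed_segment (center N u) (center N v) \<subseteq> chain_region N l r T"
proof -
  have y01: "0 \<le> y \<and> y \<le> 1" if "0 \<le> N * y" "N * y \<le> N" for y :: real
    using that N by (simp add: zero_le_mult_iff)
  have vertical: "closed_segment (center N (i, j)) (center N (i, Suc j)) \<subseteq> chain_region N l r T"
    if ij: "(i, j) \<in> S" "(i, Suc j) \<in> S" for i j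
  proof (clarify)
    fix x y assume "(x, y) \<in> closed_segment (center N (i, j)) (center N (i, Suc j))"
    then obtain t where t: "0 \<le> t" "t \<le> 1" "N * x = real i + 1/2" "N * y = real j + 1/2 + t"
      by (elim center_segmentE[OF N]) auto
    have lr: "l \<le> i" "Suc i \<le> r" "Suc (Suc j) \<le> N"
      using ij S by auto
    show "(x, y) \<in> chain_region N l r T"
    proof (rule chain_regionI[OF N ST])
      fix k k' assume "(x, y) \<in> grid_square N k k'"
      then have "k = i" "j \<le> k'" "k' \<le> Suc j"
        unfolding in_grid_square_iff[OF N] using t by linarith+
      then show "(k, k') \<in> S"
        using ij by (auto simp: le_Suc_eq)
    next
      show "real l < N * x" "N * x < real r"
        using t lr by linarith+
      show "0 \<le> y" "y \<le> 1"
        using y01[of y] t lr by linarith+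
    qed
  qed
  have horizontal: "closed_segment (center N (i, j)) (center N (Suc i, j)) \<subseteq> chain_region N l r T"
    if ij: "(i, j) \<in> S" "(Suc i, j) \<in> S" for i j
  proof (clarify)
    fix x y assume "(x, y) \<in> closed_segment (center N (i, j)) (center N (Suc i, j))"
    then obtain t where t: "0 \<le> t" "t \<le> 1" "N * x = real i + 1/2 + t" "N * y = real j + 1/2"
      by (elim center_segmentE[OF N]) auto
    have lr: "l \<le> i" "Suc (Suc i) \<le> r" "Suc j \<le> N"
      using ij S by auto
    show "(x, y) \<in> chain_region N l r T"
    proof (rule chain_regionI[OF N ST])
      fix k k' assume "(x, y) \<in> grid_square N k k'"
      then have "k' = j" "i \<le> k" "k \<le> Suc i"
        unfolding in_grid_square_iff[OF N] using t by linarith+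
      then show "(k, k') \<in> S"
        using ij by (auto simp: le_Suc_eq)
    next
      show "real l < N * x" "N * x < real r"
        using t lr by linarith+
      show "0 \<le> y" "y \<le> 1"
        using y01[of y] t lr by linarith+
    qed
  qed
  obtain i j i' j' where [simp]: "u = (i, j)" "v = (i', j')" by (metis surj_pair)
  consider "i' = i" "j' = Suc j" | "i' = i" "j = Suc j'" | "j' = j" "i' = Suc i" | "j' = j" "i = Suc i'"
    using uv(3) by (auto simp: adjacent_def)
  then show ?thesis
    by cases (use uv(1,2) in \<open>auto dest: vertical horizontal simp: closed_segment_commute\<close>)
qed

lemma chain_path_component:
  assumes "N > 0" "S \<inter> T = {}" "S \<subseteq> {l..<r} \<times> {..<N}"
    and chain: "(u, v) \<in> (cell_step S)\<^sup>*" "u \<in> S"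
  shows "path_component (chain_region N l r T) (center N u) (center N v)"
  using chain(1)
proof induction
  case base
  obtain i j where u: "u = (i, j)" by force
  have S: "l \<le> i" "Suc i \<le> r" "j < N"
    using chain(2) assms(3) u by auto
  have N: "N > 0" by fact
  have "center N u \<in> chain_region N l r T"
    unfolding center_def u
  proof (rule chain_regionI[OF assms(1,2)])
    fix k k'
    assume "((real (fst (i, j)) + 1/2) / N, (real (snd (i, j)) + 1/2) / N) \<in> grid_square N k k'"
    then have "real k \<le> real i + 1/2 \<and> real i + 1/2 \<le> real k + 1 \<and>
        real k' \<le> real j + 1/2 \<and> real j + 1/2 \<le> real k' + 1"
      unfolding in_grid_square_iff[OF N] using N by simp
    then have "k = i" "k' = j" by linarith+
    then show "(k, k') \<in> S" using chain(2) u by simp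
  next
    have "real l < real i + 1/2" "real i + 1/2 < real r"
      using S by linarith+
    then show "real l < N * ((real (fst (i, j)) + 1/2) / N)"
      "N * ((real (fst (i, j)) + 1/2) / N) < real r"
      using N by simp_all
  qed (use S N in \<open>auto simp: field_simps\<close>)
  then show ?case by (simp add: path_component_refl)
next
  case (step v w)
  then have "path_component (chain_region N l r T) (center N v) (center N w)"
    by (intro path_component_segment adjacent_segment_subset_chain_region[OF assms(1-3)])
      (auto simp: cell_step_def)
  with step show ?case by (blast intro: path_component_trans)
qed

text \<open>This serves to prolong a chain vertically from its end centers to the bottom and top
  edges. The inequalities in \<open>cell\<close> keep the point off the horizontal sides of its
  cell, except where such a side lies on the boundary of the unit square.\<close>

lemma column_point_in_chain_region:
  fixes y :: real
  assumes N: "N > 0" and ST: "S \<inter> T = {}" and S: "S \<subseteq> {l..<r} \<times> {..<N}"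
    and T: "T \<subseteq> UNIV \<times> {..<N}" and ij: "(i, j) \<in> S"
    and y: "0 \<le> y" "y \<le> 1"
    and cell: "j = 0 \<or> j < N * y" "j = N - 1 \<or> N * y < Suc j" "j \<le> N * y" "N * y \<le> Suc j"
  shows "((real i + 1/2) / N, y) \<in> chain_region N l r T"
\<comment> \<open>A point with \<open>y = 1\<close> also lies in a closed cell of the fictitious row
  \<open>N\<close>. Adding all rows from \<open>N\<close> on to \<open>S\<close> admits that cell,
  and keeps disjointness because \<open>T\<close> has only rows below \<open>N\<close>.\<close>
proof (rule chain_regionI[OF N, of "S \<union> UNIV \<times> {N..}"])
  have x: "N * ((real i + 1/2) / N) = real i + 1/2"
    using N by simp
  show "(S \<union> UNIV \<times> {N..}) \<inter> T = {}"
    using ST T by auto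
  have "l \<le> i" "Suc i \<le> r"
    using ij S by auto
  then show "real l < N * ((real i + 1/2) / N)" "N * ((real i + 1/2) / N) < real r"
    unfolding x by linarith+
  fix k k' assume "((real i + 1/2) / N, y) \<in> grid_square N k k'"
  then have k: "real k \<le> real i + 1/2" "real i + 1/2 \<le> real k + 1"
    "real k' \<le> N * y" "N * y \<le> real k' + 1"
    unfolding in_grid_square_iff[OF N] x by auto
  then have "k = i" by linarith
  moreover have "j \<le> k'" using k cell(1,3) by linarith
  moreover have "k' \<le> Suc j" using k cell(4) by linarith
  moreover have "j = N - 1 \<or> k' < Suc j" using k cell(2) by linarith
  ultimately show "(k, k') \<in> S \<union> UNIV \<times> {N..}"
    using ij by (auto simp: le_Suc_eq)
qed (use y in auto)

lemma in_cell_step_rtrancl: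
  assumes "(u, v) \<in> (cell_step S)\<^sup>*" "u \<in> S"
  shows "v \<in> S"
  using assms by induction (auto simp: cell_step_def)

text \<open>The chain, prolonged to both horizontal edges, gives a path \<open>g\<close> that misses
  \<open>K\<close>. Since \<open>K\<close> is merely connected, it is replaced by a path from
  \<open>p\<close> to \<open>q\<close> in the complement \<open>U\<close> of \<open>g\<close>;
  prolonged to the left and right edges, that path would have to meet \<open>g\<close>.\<close>

lemma chain_separates:
  assumes N: "N > 0" and ST: "S \<inter> T = {}" and S: "S \<subseteq> {l..<r} \<times> {..<N}" and "r \<le> N"
    and T: "T \<subseteq> UNIV \<times> {..<N}"
    and chain: "((i, 0), (i', N - 1)) \<in> (cell_step S)\<^sup>*" "(i, 0) \<in> S"
    and K: "connected K" "K \<subseteq> {0..1} \<times> {0..1}" "K \<subseteq> (\<Union>(i, j)\<in>T. grid_square N i j)"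
    and p: "p \<in> K" "fst p \<le> real l / N" and q: "q \<in> K" "fst q \<ge> real r / N"
  shows False
proof -
  let ?R = "chain_region N l r T"
  have end_in: "(i', N - 1) \<in> S"
    using in_cell_step_rtrancl chain by blast
  have "path_component ?R ((real i + 1/2) / N, 0) (center N (i, 0))"
  proof (rule path_component_segment, clarify)
    fix x y assume "(x, y) \<in> closed_segment ((real i + 1/2) / N, 0) (center N (i, 0))"
    then have "x \<in> closed_segment ((real i + 1/2) / N) ((real i + 1/2) / N)"
      "y \<in> closed_segment 0 (1/2 / N)"
      by (auto simp: center_def dest!: closed_segment_PairD)
    then have "x = (real i + 1/2) / N" "0 \<le> y" "N * y \<le> 1/2"
      using N by (auto simp: closed_segment_eq_real_ivl field_simps split: if_splits)
    moreover have "y \<le> N * y"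
      using N \<open>0 \<le> y\<close> mult_right_mono[of 1 N y] by simp
    ultimately show "(x, y) \<in> ?R"
      using column_point_in_chain_region[OF N ST S T chain(2), of y] by simp
  qed
  moreover have "path_component ?R (center N (i, 0)) (center N (i', N - 1))"
    by (rule chain_path_component[OF N ST S chain])
  moreover have "path_component ?R (center N (i', N - 1)) ((real i' + 1/2) / N, 1)"
  proof (rule path_component_segment, clarify)
    fix x y assume "(x, y) \<in> closed_segment (center N (i', N - 1)) ((real i' + 1/2) / N, 1)"
    then have "x \<in> closed_segment ((real i' + 1/2) / N) ((real i' + 1/2) / N)"
      "y \<in> closed_segment ((real (N - 1) + 1/2) / N) 1"
      by (auto simp: center_def dest!: closed_segment_PairD)
    moreover have "(real (N - 1) + 1/2) / N \<le> 1"
      using N by (simp add: of_nat_diff field_simps)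
    ultimately have "x = (real i' + 1/2) / N" "y \<le> 1" "real (N - 1) + 1/2 \<le> N * y"
      using N by (auto simp: closed_segment_eq_real_ivl pos_divide_le_eq mult.commute)
    moreover have "0 \<le> N * y"
      using calculation by linarith
    then have "0 \<le> y"
      using N by (simp add: zero_le_mult_iff)
    moreover have "N * y \<le> Suc (N - 1)"
      using N \<open>y \<le> 1\<close> by (simp add: mult_left_le)
    ultimately show "(x, y) \<in> ?R"
      using column_point_in_chain_region[OF N ST S T end_in, of y] by simp
  qed
  ultimately have "path_component ?R ((real i + 1/2) / N, 0) ((real i' + 1/2) / N, 1)"
    by (meson path_component_trans)
  then obtain g where g: "path g" "path_image g \<subseteq> ?R"
    "pathstart g = ((real i + 1/2) / N, 0)" "pathfinish g = ((real i' + 1/2) / N, 1)"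
    by (auto simp: path_component_def)
  define Q :: "(real \<times> real) set" where "Q = {0..1} \<times> {0..1}"
  define U where "U = Q - path_image g"
  have lr: "real l / N \<ge> 0" "real r / N \<le> 1"
    using \<open>r \<le> N\<close> N by auto
  \<comment> \<open>The path \<open>g\<close> stays strictly between the two vertical lines. This
    puts into \<open>U\<close> the horizontal segments joining \<open>p\<close> to the left edge and
    \<open>q\<close> to the right edge.\<close>
  have side: "a \<in> U" if "a \<in> Q" "fst a \<le> real l / N \<or> fst a \<ge> real r / N" for a
    using that g(2) by (auto simp: U_def chain_region_def)
  have "U = Q \<inter> - path_image g"
    by (auto simp: U_def)
  \<comment> \<open>A relatively open subset of a convex set is locally path connected, so in
    \<open>U\<close> connected components and path components agree. This turns the connected set
    \<open>K\<close> into a path.\<close>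
  then have "openin (top_of_set Q) U"
    using closed_path_image[OF g(1)] by (simp add: openin_open_Int open_Compl)
  moreover have "convex Q"
    by (simp add: Q_def convex_Times)
  ultimately have "locally path_connected U"
    using convex_imp_locally_path_connected locally_open_subset by blast
  moreover have "K \<subseteq> U"
    using K(2,3) g(2) by (auto simp: U_def Q_def chain_region_def)
  ultimately have "path_component U p q"
    using K(1) p(1) q(1) connected_component_def path_component_eq_connected_component by metis
  moreover have "path_component U (0, snd p) p"
  proof (rule path_component_segment, clarify)
    fix x y assume "(x, y) \<in> closed_segment (0, snd p) p"
    then have "x \<in> closed_segment 0 (fst p)" "y \<in> closed_segment (snd p) (snd p)"
      using closed_segment_PairD[of x y 0 "snd p" "fst p" "snd p"] by auto
    moreover have "p \<in> Q"
      using p K(2) by (auto simp: Q_def)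
    ultimately show "(x, y) \<in> U"
      using p by (intro side) (auto simp: Q_def closed_segment_eq_real_ivl split: if_splits)
  qed
  moreover have "path_component U q (1, snd q)"
  proof (rule path_component_segment, clarify)
    fix x y assume "(x, y) \<in> closed_segment q (1, snd q)"
    then have "x \<in> closed_segment (fst q) 1" "y \<in> closed_segment (snd q) (snd q)"
      using closed_segment_PairD[of x y "fst q" "snd q" 1 "snd q"] by auto
    moreover have "q \<in> Q"
      using q K(2) by (auto simp: Q_def)
    ultimately show "(x, y) \<in> U"
      using q by (intro side) (auto simp: Q_def closed_segment_eq_real_ivl split: if_splits)
  qed
  ultimately have "path_component U (0, snd p) (1, snd q)"
    by (meson path_component_trans)
  then obtain f where f: "path f" "path_image f \<subseteq> U"
    "pathstart f = (0, snd p)" "pathfinish f = (1, snd q)"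
    by (auto simp: path_component_def)
  have "{real l / N<..<real r / N} \<subseteq> {0..1}"
    using lr by (auto intro: order_trans[OF lr(1) less_imp_le])
  then have "path_image g \<subseteq> {0..1} \<times> {0..1}"
    using g(2) unfolding chain_region_def by blast
  moreover have "path_image f \<subseteq> {0..1} \<times> {0..1}"
    using f(2) by (auto simp: U_def Q_def)
  ultimately have "path_image f \<inter> path_image g \<noteq> {}"
    using f g by (intro fashoda_prod) auto
  then show False
    using f(2) by (auto simp: U_def)
qed

section \<open>Cell indices of the limit set\<close>

fun width :: "(nat \<Rightarrow> nat) \<Rightarrow> nat \<Rightarrow> nat" where
  "width m 0 = 1"
| "width m (Suc n) = width m n * m (Suc n)"

text \<open>Cells are indexed in the full grid of width \<open>width m n\<close>: the quotients give
  the parent square, the remainders the position inside it. Level 0 is the unit square itself, so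
  the recursion needs no special first step.\<close>

fun level_cells :: "(nat \<Rightarrow> nat) \<Rightarrow> (nat \<Rightarrow> (nat \<times> nat) set) \<Rightarrow> nat \<Rightarrow> (nat \<times> nat) set" where
  "level_cells m D 0 = {(0, 0)}"
| "level_cells m D (Suc n) =
     {(i, j). (i div m (Suc n), j div m (Suc n)) \<in> level_cells m D n \<and>
              (i mod m (Suc n), j mod m (Suc n)) \<in> D (Suc n)}"

lemma width_pos: "(\<And>k. k \<ge> 1 \<Longrightarrow> m k > 0) \<Longrightarrow> width m n > 0"
  by (induction n) auto

lemma level_cells_bounded:
  assumes "\<And>k. k \<ge> 1 \<Longrightarrow> m k > 0"
  shows "level_cells m D n \<subseteq> {..<width m n} \<times> {..<width m n}"
proof (induction n)
  case (Suc n)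
  have "i < width m n * m (Suc n)" if "i div m (Suc n) < width m n" for i
    using that assms[of "Suc n"] by (simp add: div_less_iff_less_mult)
  with Suc show ?case by auto
qed simp

lemma level_cells_swap:
  "level_cells m (\<lambda>k. prod.swap ` D k) n = prod.swap ` level_cells m D n"
proof (induction n)
  case (Suc n)
  have mem: "(i, j) \<in> prod.swap ` X \<longleftrightarrow> (j, i) \<in> X" for i j :: nat and X
    by force
  show ?case
    by (auto simp: Suc mem)
qed simp

text \<open>Placing cell \<open>(i, j)\<close> of the next pattern into square \<open>(a, b)\<close>
  gives the cell \<open>(a * m k + i, b * m k + j)\<close> of the finer grid. Division with
  remainder undoes this.\<close>

lemma white_squares_eq:
  assumes m: "\<And>k. k \<ge> 1 \<Longrightarrow> m k > 0" and C: "\<And>k. k \<ge> 1 \<Longrightarrow> C k \<subseteq> grid (m k)"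
  shows "white_squares C (Suc n) =
    (\<lambda>(i, j). grid_square (width m (Suc n)) i j) ` level_cells m (\<lambda>k. cells (m k) (C k)) (Suc n)"
proof (induction n)
  case 0
  have "C 1 = (\<lambda>(i, j). grid_square (m 1) i j) ` cells (m 1) (C 1)"
    using C[of 1] by (fastforce simp: cells_def grid_def)
  moreover have "(i div m 1, j div m 1) = (0, 0) \<and> (i mod m 1, j mod m 1) \<in> cells (m 1) (C 1) \<longleftrightarrow>
      (i, j) \<in> cells (m 1) (C 1)" for i j
    using m[of 1] by (auto simp: cells_def div_eq_0_iff)
  ultimately show ?case by simp
next
  case (Suc n)
  define M where "M = width m (Suc n)"
  define k where "k = Suc (Suc n)"
  define P where "P = level_cells m (\<lambda>k. cells (m k) (C k)) (Suc n)"
  define D where "D = cells (m k) (C k)"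
  have M: "M > 0" and mk: "m k > 0"
    using width_pos m by (auto simp: M_def k_def)
  have IH: "white_squares C (Suc n) = (\<lambda>(i, j). grid_square M i j) ` P"
    using Suc by (simp add: M_def P_def)
  have Ck: "C k = (\<lambda>(i, j). grid_square (m k) i j) ` D"
    using C[of k] by (fastforce simp: cells_def grid_def D_def k_def)
  have D: "i < m k" "j < m k" if "(i, j) \<in> D" for i j
    using that by (auto simp: D_def cells_def)
  have level: "white_squares C k = {sq_map x y q ` W | x y q W.
     W \<in> C k \<and> q > 0 \<and> square x y q \<in> white_squares C (Suc n)}"
    by (simp add: k_def)
  have "white_squares C k =
      {grid_square (M * m k) (a * m k + i) (b * m k + j) | a b i j. (i, j) \<in> D \<and> (a, b) \<in> P}"
  proof (intro subset_antisym subsetI)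
    fix Z assume "Z \<in> white_squares C k"
    then obtain x y q W where Z: "Z = sq_map x y q ` W" "W \<in> C k" "q > 0"
      "square x y q \<in> white_squares C (Suc n)"
      unfolding level by blast
    obtain a b where ab: "square x y q = grid_square M a b" "(a, b) \<in> P"
      using Z(4) unfolding IH by auto
    obtain i j where ij: "W = grid_square (m k) i j" "(i, j) \<in> D"
      using Z(2) unfolding Ck by auto
    \<comment> \<open>A square of positive side determines its corner and side length, so the map
      used for refinement is the one belonging to the cell \<open>(a, b)\<close>.\<close>
    have "x = real a / M" "y = real b / M" "q = 1 / M"
      using ab(1) Z(3) M by (auto simp: grid_square_eq_square square_eq_iff)
    then have "Z = grid_square (M * m k) (a * m k + i) (b * m k + j)"
      using Z(1) ij(1) sq_map_grid_square[OF M mk] by simp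
    with ab ij show "Z \<in> {grid_square (M * m k) (a * m k + i) (b * m k + j) | a b i j.
        (i, j) \<in> D \<and> (a, b) \<in> P}"
      by blast
  next
    fix Z assume "Z \<in> {grid_square (M * m k) (a * m k + i) (b * m k + j) | a b i j.
        (i, j) \<in> D \<and> (a, b) \<in> P}"
    then obtain a b i j where "Z = grid_square (M * m k) (a * m k + i) (b * m k + j)"
      and ij: "(i, j) \<in> D" and ab: "(a, b) \<in> P"
      by blast
    then have Z: "Z = sq_map (real a / M) (real b / M) (1 / M) ` grid_square (m k) i j"
      using sq_map_grid_square[OF M mk] by simp
    have W: "grid_square (m k) i j \<in> C k"
      using ij by (simp add: D_def cells_def)
    have pos: "(1 / M :: real) > 0"
      using M by simp
    have "square (real a / M) (real b / M) (1 / M) = grid_square M a b"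
      by (simp add: grid_square_eq_square)
    then have "square (real a / M) (real b / M) (1 / M) \<in> white_squares C (Suc n)"
      unfolding IH using ab by (intro image_eqI[of _ _ "(a, b)"]) simp_all
    with Z W pos show "Z \<in> white_squares C k"
      unfolding level mem_Collect_eq by (intro exI conjI)
  qed
  also have "\<dots> = (\<lambda>(i, j). grid_square (M * m k) i j) `
      {(i, j). (i div m k, j div m k) \<in> P \<and> (i mod m k, j mod m k) \<in> D}"
  proof (intro subset_antisym subsetI)
    fix Z assume "Z \<in> {grid_square (M * m k) (a * m k + i) (b * m k + j) | a b i j.
      (i, j) \<in> D \<and> (a, b) \<in> P}"
    then obtain a b i j where "Z = grid_square (M * m k) (a * m k + i) (b * m k + j)"
      "(i, j) \<in> D" "(a, b) \<in> P"
      by blast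
    then show "Z \<in> (\<lambda>(i, j). grid_square (M * m k) i j) `
        {(i, j). (i div m k, j div m k) \<in> P \<and> (i mod m k, j mod m k) \<in> D}"
      using D mk by (intro image_eqI[of _ _ "(a * m k + i, b * m k + j)"]) auto
  next
    fix Z assume "Z \<in> (\<lambda>(i, j). grid_square (M * m k) i j) `
        {(i, j). (i div m k, j div m k) \<in> P \<and> (i mod m k, j mod m k) \<in> D}"
    then obtain i j where "Z = grid_square (M * m k) i j" "(i div m k, j div m k) \<in> P"
      "(i mod m k, j mod m k) \<in> D"
      by auto
    then show "Z \<in> {grid_square (M * m k) (a * m k + i) (b * m k + j) | a b i j.
        (i, j) \<in> D \<and> (a, b) \<in> P}"
      unfolding mem_Collect_eq
      by (intro exI[of _ "i div m k"] exI[of _ "j div m k"] exI[of _ "i mod m k"]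
          exI[of _ "j mod m k"]) simp
  qed
  finally show ?case
    by (simp add: M_def k_def P_def D_def)
qed

section \<open>Crossings of a column of squares\<close>

lemma cell_step_rtrancl_mono: "S \<subseteq> T \<Longrightarrow> (cell_step S)\<^sup>* \<subseteq> (cell_step T)\<^sup>*"
  by (intro rtrancl_mono) (auto simp: cell_step_def)

lemma rtrancl_cell_step_map:
  assumes "(u, v) \<in> (cell_step S)\<^sup>*"
    and "\<And>u. u \<in> S \<Longrightarrow> f u \<in> T" "\<And>u v. adjacent u v \<Longrightarrow> adjacent (f u) (f v)"
  shows "(f u, f v) \<in> (cell_step T)\<^sup>*"
  using assms(1)
proof induction
  case (step v w)
  then have "(f v, f w) \<in> cell_step T"
    using assms(2,3) by (auto simp: cell_step_def)
  with step show ?case by simp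
qed simp

lemma vertical_line_chain:
  assumes "\<And>k. k \<le> n \<Longrightarrow> (i, k) \<in> S"
  shows "((i, 0), (i, n)) \<in> (cell_step S)\<^sup>*"
  using assms
proof (induction n)
  case (Suc n)
  then have "((i, n), (i, Suc n)) \<in> cell_step S"
    by (simp add: cell_step_def adjacent_def)
  with Suc show ?case
    by (meson le_SucI rtrancl.rtrancl_into_rtrancl)
qed simp

text \<open>With \<open>W\<close> the squares kept so far and \<open>B\<close> the cells removed in
  the next step, these are the discarded finer cells of column \<open>a\<close> inside its lowest
  \<open>b\<close> squares. The implication admits every subcell of a square that is already
  gone.\<close>

definition column_cells ::
    "nat \<Rightarrow> (nat \<times> nat) set \<Rightarrow> (nat \<times> nat) set \<Rightarrow> nat \<Rightarrow> nat \<Rightarrow> (nat \<times> nat) set" where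
  "column_cells m B W a b = {(i, j). i div m = a \<and> j < b * m \<and>
     ((i div m, j div m) \<in> W \<longrightarrow> (i mod m, j mod m) \<in> B)}"

text \<open>Every square of the column is crossed from offset \<open>i\<close> at its bottom to the
  same offset \<open>i\<close> at its top. The top cell of one crossing is therefore directly below
  the first cell of the next, and induction on the number of squares joins them.\<close>

lemma column_crossing:
  assumes m: "m > 0" and B: "B \<subseteq> {..<m} \<times> {..<m}" and "vertical_crossing m B" and "b > 0"
  obtains i where "(i, 0) \<in> column_cells m B W a b"
    "((i, 0), (i, b * m - 1)) \<in> (cell_step (column_cells m B W a b))\<^sup>*"
proof -
  let ?S = "column_cells m B W a"
  obtain i where i: "i < m" "(i, 0) \<in> B" "((i, 0), (i, m - 1)) \<in> (cell_step B)\<^sup>*"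
    using assms(3) by (auto simp: vertical_crossing_def)
  have block: "(a * m + i, b * m) \<in> ?S (Suc b) \<and>
      ((a * m + i, b * m), (a * m + i, b * m + (m - 1))) \<in> (cell_step (?S (Suc b)))\<^sup>*" for b
  proof -
    \<comment> \<open>A kept square is crossed by the chain of the pattern, a discarded one by the
      straight vertical line at the same offset \<open>i\<close>.\<close>
    define B' where "B' = (if (a, b) \<in> W then B else {..<m} \<times> {..<m})"
    have "((i, 0), (i, m - 1)) \<in> (cell_step B')\<^sup>*" "(i, 0) \<in> B'"
      using i m vertical_line_chain[of "m - 1" i "{..<m} \<times> {..<m}"] by (auto simp: B'_def)
    moreover have f: "(\<lambda>(k, j). (a * m + k, b * m + j)) u \<in> ?S (Suc b)" if "u \<in> B'" for u
      using that B m by (auto simp: B'_def column_cells_def split: if_splits)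
    ultimately show ?thesis
      using rtrancl_cell_step_map[of "(i, 0)" "(i, m - 1)" B' "\<lambda>(k, j). (a * m + k, b * m + j)"]
        f[of "(i, 0)"]
      by (auto simp: adjacent_def)
  qed
  have "(a * m + i, 0) \<in> ?S (Suc b) \<and>
      ((a * m + i, 0), (a * m + i, Suc b * m - 1)) \<in> (cell_step (?S (Suc b)))\<^sup>*" for b
  proof (induction b)
    case 0
    show ?case using block[of 0] by simp
  next
    case (Suc b)
    have mono: "?S (Suc b) \<subseteq> ?S (Suc (Suc b))"
      by (auto simp: column_cells_def)
    let ?R = "cell_step (?S (Suc (Suc b)))"
    have "((a * m + i, 0), (a * m + i, Suc b * m - 1)) \<in> ?R\<^sup>*"
      using Suc cell_step_rtrancl_mono[OF mono] by blast
    also have "(a * m + i, Suc b * m - 1) \<in> ?S (Suc (Suc b))"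
      using in_cell_step_rtrancl Suc mono by blast
    then have "((a * m + i, Suc b * m - 1), (a * m + i, Suc b * m)) \<in> ?R"
      using block[of "Suc b"] m by (auto simp: cell_step_def adjacent_def)
    also have "((a * m + i, Suc b * m), (a * m + i, Suc b * m + (m - 1))) \<in> ?R\<^sup>*"
      using block by blast
    also have "Suc b * m + (m - 1) = Suc (Suc b) * m - 1"
      using m by simp
    finally show ?case
      using Suc mono by blast
  qed
  from this[of "b - 1"] show thesis
    using that \<open>b > 0\<close> by auto
qed

section \<open>Connected subsets of the limit set have constant coordinates\<close>

lemma width_ge_power:
  assumes "\<And>k. k \<ge> 1 \<Longrightarrow> m k \<ge> c"
  shows "width m n \<ge> c ^ n"
proof (induction n)
  case (Suc n)
  then show ?case
    using mult_le_mono[OF Suc assms[of "Suc n"]] by (simp add: mult.commute)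
qed simp

text \<open>If two points of \<open>K\<close> had different first coordinates, then at a fine enough
  level a whole column of squares would lie between them. The discarded cells crossing that column,
  taken one level deeper, would separate \<open>K\<close>.\<close>

lemma connected_subset_levels_same_fst:
  assumes m: "\<And>k. k \<ge> 1 \<Longrightarrow> m k \<ge> 2"
    and B: "\<And>k. k \<ge> 1 \<Longrightarrow> B k \<subseteq> {..<m k} \<times> {..<m k}"
    and BD: "\<And>k. k \<ge> 1 \<Longrightarrow> B k \<inter> D k = {}"
    and cross: "\<And>k. k \<ge> 1 \<Longrightarrow> vertical_crossing (m k) (B k)"
    and K: "connected K"
      "\<And>n. K \<subseteq> (\<Union>(i, j)\<in>level_cells m D (Suc n). grid_square (width m (Suc n)) i j)"
    and p: "p \<in> K" and q: "q \<in> K"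
  shows "\<not> fst p < fst q"
proof
  assume less: "fst p < fst q"
  have m0: "m k > 0" if "k \<ge> 1" for k
    using m[OF that] by simp
  have unit: "K \<subseteq> {0..1} \<times> {0..1}"
  proof
    fix z assume "z \<in> K"
    then obtain i j where ij: "(i, j) \<in> level_cells m D (Suc 0)"
      "z \<in> grid_square (width m (Suc 0)) i j"
      using K(2)[of 0] by blast
    have "i < m (Suc 0)" "j < m (Suc 0)"
      using ij(1) level_cells_bounded[of m D "Suc 0"] m0 by auto
    moreover obtain x y where [simp]: "z = (x, y)" by force
    moreover have "real i \<le> m (Suc 0) * x \<and> m (Suc 0) * x \<le> real i + 1 \<and>
        real j \<le> m (Suc 0) * y \<and> m (Suc 0) * y \<le> real j + 1"
      using ij(2) m0[of "Suc 0"] by (simp add: in_grid_square_iff)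
    ultimately have "0 \<le> m (Suc 0) * x" "m (Suc 0) * x \<le> m (Suc 0)"
      "0 \<le> m (Suc 0) * y" "m (Suc 0) * y \<le> m (Suc 0)"
      by linarith+
    moreover have "real (m (Suc 0)) > 0"
      using m0[of "Suc 0"] by simp
    ultimately show "z \<in> {0..1} \<times> {0..1}"
      by (simp add: zero_le_mult_iff mult_le_cancel_left2)
  qed
  \<comment> \<open>The horizontal gap must exceed two side lengths: up to one to reach the next
    grid line to the right of \<open>p\<close>, and one for the column itself.\<close>
  obtain n where n: "2 / (fst q - fst p) < 2 ^ n"
    using real_arch_pow[of 2] by auto
  define M where "M = width m n"
  define k where "k = m (Suc n)"
  define T where "T = level_cells m D (Suc n)"
  have M: "M > 0" and k: "k > 0"
    using width_pos m0 by (auto simp: M_def k_def)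
  have "(2::real) ^ n \<le> M"
    using width_ge_power[of 2 m n] m unfolding M_def by (metis of_nat_le_iff of_nat_numeral of_nat_power)
  with n have "2 / (fst q - fst p) < M"
    by linarith
  then have gap: "M * fst p + 2 < M * fst q"
    using less by (simp add: field_simps)
  \<comment> \<open>Column \<open>a\<close> starts at the first grid line strictly to the right of
    \<open>p\<close>. Its right side lies at most two side lengths beyond \<open>p\<close>, hence to
    the left of \<open>q\<close>.\<close>
  define a where "a = Suc (nat \<lfloor>M * fst p\<rfloor>)"
  have "0 \<le> M * fst p"
    using p unit by auto
  then have a: "M * fst p \<le> a" "a \<le> M * fst p + 1"
    unfolding a_def by linarith+
  have "M * fst q \<le> M"
    using q unit M by auto
  with a gap have aM: "Suc a \<le> M"
    by linarith
  obtain i where i: "(i, 0) \<in> column_cells k (B (Suc n)) (level_cells m D n) a M"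
    "((i, 0), (i, M * k - 1)) \<in> (cell_step (column_cells k (B (Suc n)) (level_cells m D n) a M))\<^sup>*"
    using column_crossing[OF k] B cross M unfolding k_def by (metis le_add1 plus_1_eq_Suc)
  have cancel: "real (c * k) / real (M * k) = real c / M" for c
    using k by simp
  show False
  proof (rule chain_separates[OF _ _ _ _ _ i(2,1) K(1) unit _ p _ q])
    show "M * k > 0" "Suc a * k \<le> M * k"
      using M k mult_le_mono1[OF aM, of k] by simp_all
    \<comment> \<open>A cell in \<open>T\<close> has a kept parent and its remainders in
      \<open>D (Suc n)\<close>; a column cell with a kept parent has them in the disjoint set
      \<open>B (Suc n)\<close>.\<close>
    show "column_cells k (B (Suc n)) (level_cells m D n) a M \<inter> T = {}"
      using BD[of "Suc n"] by (auto simp: column_cells_def T_def k_def)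
    show "column_cells k (B (Suc n)) (level_cells m D n) a M \<subseteq> {a * k..<Suc a * k} \<times> {..<M * k}"
      using k by (auto simp: column_cells_def dividend_less_div_times div_times_less_eq_dividend)
    show "T \<subseteq> UNIV \<times> {..<M * k}"
      using level_cells_bounded[of m D "Suc n"] m0 by (auto simp: T_def M_def k_def)
    show "K \<subseteq> (\<Union>(i, j)\<in>T. grid_square (M * k) i j)"
      using K(2)[of n] by (simp add: T_def M_def k_def)
    show "fst p \<le> real (a * k) / real (M * k)" "real (Suc a * k) / real (M * k) \<le> fst q"
      unfolding cancel using a gap M by (simp_all add: field_simps)
  qed
qed

theorem proposition8:
  fixes m :: "nat \<Rightarrow> nat" and A :: "nat \<Rightarrow> (real \<times> real) set set"
  assumes "\<And>k. k \<ge> 1 \<Longrightarrow> labyrinth_pattern (m k) (A k)"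
  shows "generalised_sierpinski_carpet (limit_set (\<lambda>k. complementary_pattern (m k) (A k))) \<and>
         totally_disconnected (limit_set (\<lambda>k. complementary_pattern (m k) (A k)))"
proof
  define C where "C = (\<lambda>k. complementary_pattern (m k) (A k))"
  define D where "D = (\<lambda>k. cells (m k) (C k))"
  have m: "m k \<ge> 3" if "k \<ge> 1" for k
    using assms[OF that] by (simp add: labyrinth_pattern_def)
  have m2: "m k \<ge> 2" and m0: "m k > 0" if "k \<ge> 1" for k
    using m[OF that] by auto
  have C_grid: "C k \<subseteq> grid (m k)" for k
    by (auto simp: C_def complementary_pattern_def)
  \<comment> \<open>The complement is nonempty by the corner condition: two diagonally opposite
    corner squares are not both white.\<close>
  have "pattern (m k) (C k)" if "k \<ge> 1" for k
  proof -
    have "grid_square (m k) 0 0 \<in> A k \<longrightarrow> grid_square (m k) (m k - 1) (m k - 1) \<notin> A k"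
      using assms[OF that] by (auto simp: labyrinth_pattern_def)
    moreover have "grid_square (m k) 0 0 \<in> grid (m k)"
      "grid_square (m k) (m k - 1) (m k - 1) \<in> grid (m k)"
      using m0[OF that] by (force simp: grid_def)+
    ultimately have "C k \<noteq> {}"
      by (auto simp: C_def complementary_pattern_def)
    then show ?thesis
      using C_grid m0[OF that] by (simp add: pattern_def)
  qed
  then show "generalised_sierpinski_carpet (limit_set (\<lambda>k. complementary_pattern (m k) (A k)))"
    unfolding generalised_sierpinski_carpet_def C_def[symmetric] by blast
  have point: "p = q"
    if K: "connected K" "K \<subseteq> limit_set C" and pq: "p \<in> K" "q \<in> K" for K p q
  proof -
    have levels: "K \<subseteq> (\<Union>(i, j)\<in>level_cells m D (Suc n). grid_square (width m (Suc n)) i j)" for n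
    proof -
      have "K \<subseteq> \<Union>(white_squares C (Suc n))"
        using K(2) by (force simp: limit_set_def)
      then show ?thesis
        using white_squares_eq[of m C n] m0 C_grid by (simp add: D_def case_prod_unfold)
    qed
    \<comment> \<open>The reflected set lies in the levels built from the reflected patterns. There
      the horizontal exit pairs supply vertical crossings, so the result on first coordinates yields
      equality of the second ones.\<close>
    have "prod.swap ` K \<subseteq> prod.swap ` (\<Union>(i, j)\<in>level_cells m D (Suc n).
        grid_square (width m (Suc n)) i j)" for n
      using levels by (intro image_mono)
    also have "prod.swap ` (\<Union>(i, j)\<in>level_cells m D (Suc n). grid_square (width m (Suc n)) i j) =
        (\<Union>(i, j)\<in>level_cells m (\<lambda>k. prod.swap ` D k) (Suc n). grid_square (width m (Suc n)) i j)" for n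
      unfolding level_cells_swap by (auto simp: image_UN swap_grid_square case_prod_unfold)
    finally have swap_levels: "prod.swap ` K \<subseteq>
      (\<Union>(i, j)\<in>level_cells m (\<lambda>k. prod.swap ` D k) (Suc n). grid_square (width m (Suc n)) i j)" for n .
    have swap_conn: "connected (prod.swap ` K)"
      by (rule connected_continuous_image[OF _ K(1)]) (rule continuous_on_swap)
    have cells: "cells (m k) (A k) \<subseteq> {..<m k} \<times> {..<m k}" for k
      by (auto simp: cells_def)
    have disjoint: "cells (m k) (A k) \<inter> D k = {}" for k
      by (auto simp: D_def C_def cells_def complementary_pattern_def)
    note cross = labyrinth_pattern_crossings[OF assms]
    have "\<not> fst p < fst q" if "p \<in> K" "q \<in> K" for p q
      by (rule connected_subset_levels_same_fst[OF m2 cells disjoint cross(1) K(1) levels that])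
    then have "fst p = fst q"
      using pq by (meson linorder_neqE)
    moreover have "\<not> fst p < fst q" if "p \<in> prod.swap ` K" "q \<in> prod.swap ` K" for p q
      by (rule connected_subset_levels_same_fst[OF m2 _ _ cross(2) swap_conn swap_levels that])
        (use cells disjoint in fastforce)+
    then have "snd p = snd q"
      using pq by (metis imageI fst_swap linorder_neqE)
    ultimately show "p = q"
      by (simp add: prod_eqI)
  qed
  have "connected_component_set (limit_set C) x = {x}" if "x \<in> limit_set C" for x
  proof -
    have "x \<in> connected_component_set (limit_set C) x"
      using that by (simp add: connected_component_refl)
    moreover have "y = x" if "y \<in> connected_component_set (limit_set C) x" for y
      by (rule point[OF connected_connected_component connected_component_subset that calculation])
    ultimately show ?thesis
      by blast
  qed
  then show "totally_disconnected (limit_set (\<lambda>k. complementary_pattern (m k) (A k)))"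
    unfolding totally_disconnected_def C_def by blast
qed

end
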